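(* Let $f_1,\dots,f_m:\mathbb{M}\to\mathbb{R}$ ($m\ge2$) be convex functions of class $C^1$, let $k_1,\dots,k_m\in\mathbb{R}$, and let $C=\{\sigma\in\mathbb{M} : f_i(\sigma)\le k_i,\ i=1,\dots,m\}$. Assume that there is $\sigma^\star\in\mathbb{M}$ with $f_i(\sigma^\star)<k_i$ for all $i$, and that $\sigma+pI\in C$ for all $\sigma\in C$, $p\in\mathbb{R}$. Let $\sigma\in C$ be such that $f_i(\sigma)=k_i$ for $i=1,2$ and $f_i(\sigma)<k_i$ for all $i\ge3$, and assume that $\nabla f_1(\sigma)$ and $\nabla f_2(\sigma)$ are not collinear. For $\dot\varepsilon\in\mathbb{M}$ let $$\alpha_i=\frac{\dot\varepsilon:\nabla f_i(\sigma)}{\|\nabla f_i(\sigma)\|}\ (i=1,2),\quad \delta=\frac{\nabla f_1(\sigma):\nabla f_2(\sigma)}{\|\nabla f_1(\sigma)\|\,\|\nabla f_2(\sigma)\|},\quad \eta_1=\frac{\alpha_1-\delta\alpha_2}{1-\delta^2},\quad \eta_2=\frac{\alpha_2-\delta\alpha_1}{1-\delta^2}.$$ Then, for $\dot\varepsilon,\dot\varepsilon^{e},\dot\varepsilon^{p},\dot\sigma\in\mathbb{M}$, the constitutive laws $$\dot\varepsilon^{e}=\Pi_{T(C,\sigma)}\dot\varepsilon,\qquad \dot\varepsilon^{p}=\Pi_{N(C,\sigma)}\dot\varepsilon,\qquad \dot\sigma=\Pi_{T(C,\sigma)}\mathbb{H}(\dot\varepsilon)$$ can be rewritten as (i.e.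 are equivalent to) $$\dot\varepsilon^{p}=\begin{cases}\eta_1\dfrac{\nabla f_1(\sigma)}{\|\nabla f_1(\sigma)\|}+\eta_2\dfrac{\nabla f_2(\sigma)}{\|\nabla f_2(\sigma)\|} & \text{if }\eta_1\ge0\text{ and }\eta_2\ge0,\\[2mm] \max(\alpha_1,0)\dfrac{\nabla f_1(\sigma)}{\|\nabla f_1(\sigma)\|} & \text{if }\min(\eta_1,\eta_2)<0\text{ and }\alpha_1\ge\alpha_2,\\[2mm] \max(\alpha_2,0)\dfrac{\nabla f_2(\sigma)}{\|\nabla f_2(\sigma)\|} & \text{if }\min(\eta_1,\eta_2)<0\text{ and }\alpha_1\le\alpha_2,\end{cases}$$ $$\dot\varepsilon^{e}=\dot\varepsilon-\dot\varepsilon^{p},\qquad \dot\sigma=\lambda\,\mathrm{tr}(\dot\varepsilon)I+2\mu\dot\varepsilon-2\mu\dot\varepsilon^{p}.$$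
   Context: $\mathbb{M}$ is the space of real symmetric $3\times3$ matrices with scalar product $\tau:\eta=\mathrm{tr}(\tau\eta)$ and associated (Frobenius) norm $\|\cdot\|$; $I$ is the identity matrix. $\nabla f(\sigma)\in\mathbb{M}$ is the gradient of $f:\mathbb{M}\to\mathbb{R}$ with respect to this scalar product, i.e. $df(\sigma)\tau=\nabla f(\sigma):\tau$ for all $\tau\in\mathbb{M}$. The elasticity operator is $\mathbb{H}(\tau)=2\mu\tau+\lambda\,\mathrm{tr}(\tau)I$, with constants $\lambda>0$, $\mu>0$. For a nonempty convex set $K\subset\mathbb{M}$ and $\sigma\in K$, the tangent cone is $T(K,\sigma)=\overline{\{\alpha(\eta-\sigma) : \eta\in K,\ \alpha>0\}}$ and the normal cone is $N(K,\sigma)=\{\eta\in\mathbb{M} : \tau:\eta\le 0\ \forall\tau\in T(K,\sigma)\}$. $\Pi_K$ denotes the orthogonal projection onto a nonempty closed convex set $K$. Here $\dot\varepsilon,\dot\varepsilon^e,\dot\varepsilon^p,\dot\sigma$ are the strain rate, elastic strain rate, plastic strain rate and stress rate; the statement concerns them simply as elements of $\mathbb{M}$. *)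

theory Defs
  imports "HOL-Analysis.Analysis"
begin

text \<open>The space of real symmetric \<open>3 \<times> 3\<close> matrices is rendered as a subspace of
  \<^typ>\<open>real^3^3\<close>.  The library inner product there is the sum of the products of the entries, so
  on symmetric matrices it is the trace product (lemma \<open>inner_eq_trace\<close>) and the library norm is
  the Frobenius norm.\<close>

definition sym_mats :: "(real^3^3) set" where
  "sym_mats = {A. transpose A = A}"

lemma inner_eq_trace:
  assumes "\<tau> \<in> sym_mats"
  shows "\<tau> \<bullet> \<eta> = trace (\<tau> ** \<eta>)"
proof -
  have "\<tau> $ i $ j = \<tau> $ j $ i" for i j
    using assms by (simp add: sym_mats_def transpose_def vec_eq_iff)
  then have "trace (\<tau> ** \<eta>) = (\<Sum>i\<in>UNIV. \<Sum>j\<in>UNIV. \<tau> $ j $ i * \<eta> $ j $ i)"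
    by (simp add: trace_def matrix_matrix_mult_def)
  also have "\<dots> = \<tau> \<bullet> \<eta>"
    by (subst sum.swap) (simp add: inner_vec_def)
  finally show ?thesis ..
qed

lemma norm_eq_trace: "\<tau> \<in> sym_mats \<Longrightarrow> norm \<tau> = sqrt (trace (\<tau> ** \<tau>))"
  by (metis inner_eq_trace norm_eq_sqrt_inner)

lemma subspace_sym_mats: "subspace sym_mats"
  by (auto simp: subspace_def sym_mats_def transpose_def vec_eq_iff)

definition elasticity :: "real \<Rightarrow> real \<Rightarrow> real^3^3 \<Rightarrow> real^3^3" where
  "elasticity lam \<mu> \<tau> = (2 * \<mu>) *\<^sub>R \<tau> + (lam * trace \<tau>) *\<^sub>R mat 1"

text \<open>Only the values of \<open>f\<close> on the symmetric matrices matter: differentiability is taken within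
  that subspace.  The derivative within the subspace is not determined as a linear map on all of
  \<^typ>\<open>real^3^3\<close>, but its representing symmetric matrix is unique (lemma \<open>sym_grad_eqI\<close>).\<close>

definition sym_grad :: "(real^3^3 \<Rightarrow> real) \<Rightarrow> real^3^3 \<Rightarrow> real^3^3" where
  "sym_grad f \<sigma> =
    (THE G. G \<in> sym_mats \<and> (f has_derivative (\<lambda>\<tau>. G \<bullet> \<tau>)) (at \<sigma> within sym_mats))"

definition C1_sym :: "(real^3^3 \<Rightarrow> real) \<Rightarrow> bool" where
  "C1_sym f \<longleftrightarrow> (\<forall>\<sigma>\<in>sym_mats. f differentiable (at \<sigma> within sym_mats)) \<and>
    continuous_on sym_mats (sym_grad f)"

lemma has_derivative_sym_line:
  assumes "(f has_derivative D) (at \<sigma> within sym_mats)" "\<sigma> \<in> sym_mats" "\<tau> \<in> sym_mats"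
  shows "((\<lambda>t. f (\<sigma> + t *\<^sub>R \<tau>)) has_derivative (\<lambda>t. D (t *\<^sub>R \<tau>))) (at (0::real))"
proof -
  have 1: "((\<lambda>t. \<sigma> + t *\<^sub>R \<tau>) has_derivative (\<lambda>t. t *\<^sub>R \<tau>)) (at (0::real))"
    by (auto intro!: derivative_eq_intros)
  have "range (\<lambda>t. \<sigma> + t *\<^sub>R \<tau>) \<subseteq> sym_mats"
    using assms subspace_sym_mats by (auto simp: subspace_add subspace_scale)
  then have 2: "(f has_derivative D) (at (\<sigma> + 0 *\<^sub>R \<tau>) within range (\<lambda>t. \<sigma> + t *\<^sub>R \<tau>))"
    using assms(1) by (auto intro: has_derivative_subset)
  show ?thesis
    using has_derivative_in_compose[OF 1 2] by simp
qed

lemma sym_grad_unique: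
  assumes "(f has_derivative (\<lambda>\<tau>. G \<bullet> \<tau>)) (at \<sigma> within sym_mats)"
    and "(f has_derivative (\<lambda>\<tau>. G' \<bullet> \<tau>)) (at \<sigma> within sym_mats)"
    and "\<sigma> \<in> sym_mats" "G \<in> sym_mats" "G' \<in> sym_mats"
  shows "G = G'"
proof -
  let ?d = "G - G'"
  have d: "?d \<in> sym_mats" using assms subspace_sym_mats by (auto simp: subspace_diff)
  have "(\<lambda>t. G \<bullet> (t *\<^sub>R ?d)) = (\<lambda>t. G' \<bullet> (t *\<^sub>R ?d))"
    using has_derivative_unique[OF has_derivative_sym_line[OF assms(1,3) d]
        has_derivative_sym_line[OF assms(2,3) d]] .
  from fun_cong[OF this, of 1] have "?d \<bullet> ?d = 0"
    by (simp add: inner_diff_left)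
  then show ?thesis by simp
qed

lemma sym_grad_eqI:
  assumes "(f has_derivative (\<lambda>\<tau>. G \<bullet> \<tau>)) (at \<sigma> within sym_mats)"
    and "\<sigma> \<in> sym_mats" "G \<in> sym_mats"
  shows "sym_grad f \<sigma> = G"
  unfolding sym_grad_def by (rule the_equality) (use assms sym_grad_unique in blast)+

lemma sym_grad_works:
  assumes "f differentiable (at \<sigma> within sym_mats)" "\<sigma> \<in> sym_mats"
  shows "sym_grad f \<sigma> \<in> sym_mats"
    and "(f has_derivative (\<lambda>\<tau>. sym_grad f \<sigma> \<bullet> \<tau>)) (at \<sigma> within sym_mats)"
proof -
  obtain D where D: "(f has_derivative D) (at \<sigma> within sym_mats)"
    using assms(1) by (auto simp: differentiable_def)
  then have lin: "linear D" by (simp add: has_derivative_bounded_linear bounded_linear.linear)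
  define w where "w = adjoint D 1"
  have w: "D x = w \<bullet> x" for x
    using adjoint_works[OF lin, of x 1] by (simp add: w_def inner_commute)
  define G where "G = (1/2) *\<^sub>R (w + transpose w)"
  have G: "G \<in> sym_mats"
    by (simp add: G_def sym_mats_def transpose_def vec_eq_iff)
  have GD: "G \<bullet> x = D x" if "x \<in> sym_mats" for x
  proof -
    have x: "x $ i $ j = x $ j $ i" for i j
      using that by (simp add: sym_mats_def transpose_def vec_eq_iff)
    have "transpose w \<bullet> x = (\<Sum>i\<in>UNIV. \<Sum>j\<in>UNIV. w $ j $ i * x $ j $ i)"
      by (simp add: inner_vec_def transpose_def x)
    also have "\<dots> = w \<bullet> x"
      by (subst sum.swap) (simp add: inner_vec_def)
    finally show ?thesis by (simp add: G_def w inner_add_left)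
  qed
  have "(f has_derivative (\<lambda>\<tau>. G \<bullet> \<tau>)) (at \<sigma> within sym_mats)"
    unfolding has_derivative_within_alt
  proof (intro conjI allI impI)
    show "bounded_linear (\<lambda>\<tau>. G \<bullet> \<tau>)" by (rule bounded_linear_inner_right)
    fix e :: real assume "0 < e"
    moreover have "G \<bullet> (y - \<sigma>) = D (y - \<sigma>)" if "y \<in> sym_mats" for y
      using that assms(2) subspace_sym_mats by (simp add: GD subspace_diff)
    ultimately show "\<exists>d>0. \<forall>y\<in>sym_mats. norm (y - \<sigma>) < d \<longrightarrow>
        norm (f y - f \<sigma> - G \<bullet> (y - \<sigma>)) \<le> e * norm (y - \<sigma>)"
      using D by (simp add: has_derivative_within_alt)
  qed
  with G sym_grad_eqI[OF this assms(2) G]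
  show "sym_grad f \<sigma> \<in> sym_mats"
    and "(f has_derivative (\<lambda>\<tau>. sym_grad f \<sigma> \<bullet> \<tau>)) (at \<sigma> within sym_mats)"
    by simp_all
qed

definition tangent_cone :: "(real^3^3) set \<Rightarrow> real^3^3 \<Rightarrow> (real^3^3) set" where
  "tangent_cone K \<sigma> = closure {\<alpha> *\<^sub>R (\<eta> - \<sigma>) | \<alpha> \<eta>. \<eta> \<in> K \<and> \<alpha> > 0}"

definition normal_cone :: "(real^3^3) set \<Rightarrow> real^3^3 \<Rightarrow> (real^3^3) set" where
  "normal_cone K \<sigma> = {\<eta> \<in> sym_mats. \<forall>\<tau> \<in> tangent_cone K \<sigma>. \<tau> \<bullet> \<eta> \<le> 0}"

end

theory Submission
  imports Defs
begin

text \<open>Every active constraint decreases strictly at \<open>\<sigma>\<close> in the Slater direction \<open>\<sigma>star - \<sigma>\<close>.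
  Adding a small multiple of this direction shows that \<open>T(C,\<sigma>)\<close> is the set of symmetric \<open>\<tau>\<close> with
  \<open>\<tau> : \<nabla>f\<^sub>1(\<sigma>) \<le> 0\<close> and \<open>\<tau> : \<nabla>f\<^sub>2(\<sigma>) \<le> 0\<close>.  By Moreau's decomposition, \<open>p\<close> and \<open>\<epsilon> - p\<close> are then the
  projections of \<open>\<epsilon>\<close> onto the normal and tangent cones as soon as \<open>p\<close> is a nonnegative combination
  of the gradients, \<open>\<epsilon> - p \<in> T(C,\<sigma>)\<close> and \<open>(\<epsilon> - p) : p = 0\<close>; the given formula satisfies these
  conditions.  Since \<open>C\<close> is invariant under hydrostatic shifts, \<open>I\<close> is orthogonal to both gradients,
  which reduces the projection of the elastic stress rate to that of \<open>2\<mu>\<epsilon>\<close>.\<close>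

section \<open>Projections and the first-order inequality for convex functions\<close>

text \<open>Expanding the square of a - x around p leaves the square of a - p, a nonnegative cross
  term and a square, so the variational inequality alone certifies the projection.\<close>

lemma closest_point_eqI:
  fixes a p :: "'a::euclidean_space"
  assumes "closed S" "convex S" "p \<in> S" "\<And>x. x \<in> S \<Longrightarrow> (a - p) \<bullet> (x - p) \<le> 0"
  shows "closest_point S a = p"
proof (rule closest_point_unique[symmetric, OF assms(2,1,3)], rule ballI)
  fix x assume "x \<in> S"
  then have "(a - p) \<bullet> (x - p) \<le> 0"
    using assms(4) by simp
  moreover have "(a - x) \<bullet> (a - x) = (a - p) \<bullet> (a - p) - 2 * ((a - p) \<bullet> (x - p)) + (x - p) \<bullet> (x - p)"
    by (simp add: inner_diff_left inner_diff_right inner_commute)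
  ultimately have "(a - p) \<bullet> (a - p) \<le> (a - x) \<bullet> (a - x)"
    using inner_ge_zero[of "x - p"] by linarith
  then show "dist a p \<le> dist a x"
    by (simp add: dist_norm norm_le)
qed

text \<open>By convexity, the difference quotients along the segment from x to y never exceed f y -
  f x, and the bound passes to the limit. Only the one-sided limit at 0 is taken, since the segment
  need not extend beyond x inside S.\<close>

lemma convex_on_derivative_le:
  fixes f :: "'a::real_normed_vector \<Rightarrow> real"
  assumes "convex_on S f" "(f has_derivative D) (at x within S)" "x \<in> S" "y \<in> S"
  shows "D (y - x) \<le> f y - f x"
proof -
  let ?l = "\<lambda>t::real. x + t *\<^sub>R (y - x)"
  have S: "?l t \<in> S" if "t \<in> {0..1}" for t
  proof -
    have "(1 - t) *\<^sub>R x + t *\<^sub>R y \<in> S"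
      using convexD[OF convex_on_imp_convex[OF assms(1)] assms(3,4), of "1 - t" t] that by simp
    then show ?thesis by (simp add: algebra_simps)
  qed
  have 1: "(?l has_derivative (\<lambda>t. t *\<^sub>R (y - x))) (at 0 within {0..1})"
    by (auto intro!: derivative_eq_intros)
  have 2: "(f has_derivative D) (at (?l 0) within ?l ` {0..1})"
    using assms(2) S by (auto intro: has_derivative_subset)
  have "((\<lambda>t. f (?l t)) has_derivative (\<lambda>t. D (t *\<^sub>R (y - x)))) (at 0 within {0..1})"
    using has_derivative_in_compose[OF 1 2] by simp
  moreover have "(\<lambda>t. D (t *\<^sub>R (y - x))) = (*) (D (y - x))"
    using assms(2) by (auto simp: has_derivative_bounded_linear bounded_linear.linear linear_scale)
  ultimately have "((\<lambda>t. f (?l t)) has_derivative (*) (D (y - x))) (at 0 within {0..1})"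
    by simp
  then have "((\<lambda>t. f (?l t)) has_field_derivative D (y - x)) (at 0 within {0..1})"
    by (simp add: has_field_derivative_def)
  then have lim: "((\<lambda>t. (f (?l t) - f x) / t) \<longlongrightarrow> D (y - x)) (at 0 within {0..1})"
    by (simp add: has_field_derivative_iff)
  have "eventually (\<lambda>t. (f (?l t) - f x) / t \<le> f y - f x) (at (0::real) within {0..1})"
    unfolding eventually_at_filter
  proof (rule always_eventually, intro allI impI)
    fix t :: real assume t: "t \<noteq> 0" "t \<in> {0..1}"
    have "f ((1 - t) *\<^sub>R x + t *\<^sub>R y) \<le> (1 - t) * f x + t * f y"
      using convex_onD[OF assms(1) _ _ assms(3,4), of t] t by simp
    then have "f (?l t) - f x \<le> (f y - f x) * t"
      by (simp add: algebra_simps)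
    then show "(f (?l t) - f x) / t \<le> f y - f x"
      using t by (simp add: pos_divide_le_eq)
  qed
  moreover have "at (0::real) within {0..1} \<noteq> bot"
    by (simp add: at_within_Icc_at_right)
  ultimately show ?thesis
    using tendsto_upperbound[OF lim] by blast
qed

section \<open>Tangent cone of a set cut out by convex constraints\<close>

text \<open>The disjunction treats both kinds of constraints at once: an inactive one stays strict
  by continuity, and an active one becomes strict because its directional derivative is
  negative.\<close>

lemma eventually_line_less:
  fixes c :: real
  assumes "(f has_derivative D) (at \<sigma> within sym_mats)" "\<sigma> \<in> sym_mats" "\<tau> \<in> sym_mats"
    and "f \<sigma> < c \<or> f \<sigma> \<le> c \<and> D \<tau> < 0"
  shows "\<forall>\<^sub>F t in at_right 0. f (\<sigma> + t *\<^sub>R \<tau>) < c"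
proof -
  have "(\<lambda>t. D (t *\<^sub>R \<tau>)) = (*) (D \<tau>)"
    using assms(1) by (auto simp: has_derivative_bounded_linear bounded_linear.linear linear_scale)
  then have "((\<lambda>t. f (\<sigma> + t *\<^sub>R \<tau>)) has_derivative (*) (D \<tau>)) (at 0)"
    using has_derivative_sym_line[OF assms(1-3)] by simp
  then have d: "((\<lambda>t. f (\<sigma> + t *\<^sub>R \<tau>)) has_real_derivative D \<tau>) (at 0)"
    by (simp add: has_field_derivative_def)
  from assms(4) show ?thesis
  proof
    assume "f \<sigma> < c"
    have "((\<lambda>t. f (\<sigma> + t *\<^sub>R \<tau>)) \<longlongrightarrow> f \<sigma>) (at_right 0)"
      using DERIV_isCont[OF d] by (auto simp: isCont_def intro: tendsto_within_subset)
    then show ?thesis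
      using \<open>f \<sigma> < c\<close> by (rule order_tendstoD)
  next
    assume *: "f \<sigma> \<le> c \<and> D \<tau> < 0"
    obtain e where "e > 0" "\<And>h. h > 0 \<Longrightarrow> h < e \<Longrightarrow> f (\<sigma> + h *\<^sub>R \<tau>) < f \<sigma>"
      using DERIV_neg_dec_right[OF d] * by auto
    then show ?thesis
      using * by (intro eventually_at_rightI[of 0 e]) force+
  qed
qed

lemma tangent_cone_active:
  fixes f :: "nat \<Rightarrow> real^3^3 \<Rightarrow> real"
  assumes "finite A"
    and cvx: "\<And>i. i \<in> A \<Longrightarrow> convex_on sym_mats (f i)"
    and df: "\<And>i. i \<in> A \<Longrightarrow> (f i has_derivative (\<lambda>\<tau>. G i \<bullet> \<tau>)) (at \<sigma> within sym_mats)"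
    and C: "C = {\<tau> \<in> sym_mats. \<forall>i\<in>A. f i \<tau> \<le> k i}"
    and star: "\<sigma>star \<in> sym_mats" "\<And>i. i \<in> A \<Longrightarrow> f i \<sigma>star < k i"
    and "\<sigma> \<in> C"
    and BA: "B \<subseteq> A" and act: "\<And>i. i \<in> B \<Longrightarrow> f i \<sigma> = k i"
    and inact: "\<And>i. i \<in> A - B \<Longrightarrow> f i \<sigma> < k i"
  shows "tangent_cone C \<sigma> = {\<tau> \<in> sym_mats. \<forall>i\<in>B. G i \<bullet> \<tau> \<le> 0}" (is "_ = ?R")
proof
  let ?S = "{\<alpha> *\<^sub>R (\<eta> - \<sigma>) | \<alpha> \<eta>. \<eta> \<in> C \<and> \<alpha> > 0}"
  have \<sigma>: "\<sigma> \<in> sym_mats" using \<open>\<sigma> \<in> C\<close> C by simp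
  \<comment> \<open>The tangent inequality for convex functions, with the value at \<sigma> replaced
    by \<open>k i\<close> because the constraint is active. At \<open>\<sigma>star\<close> the
    right-hand side is negative, which makes \<open>?d\<close> a strict descent direction.\<close>
  have grad: "G i \<bullet> (\<eta> - \<sigma>) \<le> f i \<eta> - k i" if "i \<in> B" "\<eta> \<in> sym_mats" for i \<eta>
    using convex_on_derivative_le[OF cvx df \<sigma> that(2), of i] that(1) act BA by auto
  have "?R = sym_mats \<inter> (\<Inter>i\<in>B. {\<tau>. G i \<bullet> \<tau> \<le> 0})" by auto
  then have "closed ?R"
    by (auto intro!: closed_Int closed_INT closed_halfspace_le closed_subspace[OF subspace_sym_mats])
  moreover have "?S \<subseteq> ?R"
  proof clarify
    fix \<alpha> :: real and \<eta> assume *: "\<eta> \<in> C" "\<alpha> > 0"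
    then have "\<eta> \<in> sym_mats" using C by simp
    moreover have "G i \<bullet> (\<eta> - \<sigma>) \<le> 0" if "i \<in> B" for i
      using grad[OF that \<open>\<eta> \<in> sym_mats\<close>] * that BA C by fastforce
    ultimately show "\<alpha> *\<^sub>R (\<eta> - \<sigma>) \<in> sym_mats \<and> (\<forall>i\<in>B. G i \<bullet> (\<alpha> *\<^sub>R (\<eta> - \<sigma>)) \<le> 0)"
      using \<sigma> * subspace_sym_mats
      by (auto simp: subspace_diff subspace_scale mult_nonneg_nonpos)
  qed
  ultimately show "tangent_cone C \<sigma> \<subseteq> ?R"
    unfolding tangent_cone_def by (simp add: closure_minimal)
  show "?R \<subseteq> tangent_cone C \<sigma>"
  proof
    fix \<tau> assume \<tau>: "\<tau> \<in> ?R"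
    let ?d = "\<sigma>star - \<sigma>"
    \<comment> \<open>A direction \<tau> in \<open>?R\<close> may be orthogonal to an active
      gradient and leave C at once. The perturbed direction strictly decreases every active
      constraint, so a short step along it stays in C.\<close>
    have S: "\<tau> + s *\<^sub>R ?d \<in> ?S" if "s > 0" for s
    proof -
      let ?t = "\<tau> + s *\<^sub>R ?d"
      have t: "?t \<in> sym_mats"
        using \<tau> \<sigma> star(1) subspace_sym_mats
        by (simp add: subspace_diff subspace_scale subspace_add)
      have neg: "G i \<bullet> ?t < 0" if "i \<in> B" for i
      proof -
        have "G i \<bullet> ?d < 0"
          using grad[OF that star(1)] star(2)[of i] that BA by force
        then have "s * (G i \<bullet> ?d) < 0" using \<open>s > 0\<close> by (simp add: mult_pos_neg)
        then show ?thesis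
          using \<tau> that unfolding inner_add_right inner_scaleR_right by fastforce
      qed
      \<comment> \<open>Finiteness of \<open>A\<close> provides one step length that serves all
        constraints.\<close>
      have "\<forall>\<^sub>F h in at_right 0. \<forall>i\<in>A. f i (\<sigma> + h *\<^sub>R ?t) < k i"
        using \<open>finite A\<close>
      proof (rule eventually_ball_finite, intro ballI)
        fix i assume i: "i \<in> A"
        show "\<forall>\<^sub>F h in at_right 0. f i (\<sigma> + h *\<^sub>R ?t) < k i"
          by (rule eventually_line_less[OF df[OF i] \<sigma> t])
            (use i neg act inact in \<open>cases "i \<in> B"; auto\<close>)
      qed
      then have "\<forall>\<^sub>F h::real in at_right 0. h > 0 \<and> (\<forall>i\<in>A. f i (\<sigma> + h *\<^sub>R ?t) < k i)"
        by (intro eventually_conj eventually_at_right_less)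
      then obtain h :: real where h: "h > 0" "\<forall>i\<in>A. f i (\<sigma> + h *\<^sub>R ?t) < k i"
        using eventually_happens'[OF trivial_limit_at_right_real] by blast
      then have "\<sigma> + h *\<^sub>R ?t \<in> C"
        using C \<sigma> t subspace_sym_mats by (auto simp: subspace_add subspace_scale less_imp_le)
      moreover have "?t = (1 / h) *\<^sub>R ((\<sigma> + h *\<^sub>R ?t) - \<sigma>)"
        using h by simp
      ultimately show ?thesis
        using h(1) by (metis (mono_tags, lifting) mem_Collect_eq zero_less_divide_1_iff)
    qed
    \<comment> \<open>Letting s decrease to 0 recovers \<tau>; this is where the closure in the
      tangent cone is used.\<close>
    have "((\<lambda>s. \<tau> + s *\<^sub>R ?d) \<longlongrightarrow> \<tau> + 0 *\<^sub>R ?d) (at_right 0)"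
      by (intro tendsto_intros)
    moreover have "\<forall>\<^sub>F s in at_right 0. \<tau> + s *\<^sub>R ?d \<in> closure ?S"
      using eventually_at_right_less by (rule eventually_mono) (rule subsetD[OF closure_subset S])
    ultimately show "\<tau> \<in> tangent_cone C \<sigma>"
      unfolding tangent_cone_def
      using Lim_in_closed_set[OF closed_closure _ trivial_limit_at_right_real] by fastforce
  qed
qed

section \<open>Normal cones and projection onto a cone with two generators\<close>

lemma closed_normal_cone: "closed (normal_cone K \<sigma>)"
proof -
  have "normal_cone K \<sigma> = sym_mats \<inter> (\<Inter>\<tau>\<in>tangent_cone K \<sigma>. {\<eta>. \<tau> \<bullet> \<eta> \<le> 0})"
    by (auto simp: normal_cone_def)
  then show ?thesis
    by (auto intro!: closed_Int closed_INT closed_halfspace_le closed_subspace[OF subspace_sym_mats])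
qed

lemma convex_normal_cone: "convex (normal_cone K \<sigma>)"
proof -
  have "normal_cone K \<sigma> = sym_mats \<inter> (\<Inter>\<tau>\<in>tangent_cone K \<sigma>. {\<eta>. \<tau> \<bullet> \<eta> \<le> 0})"
    by (auto simp: normal_cone_def)
  then show ?thesis
    by (auto intro!: convex_Int convex_INT convex_halfspace_le subspace_imp_convex[OF subspace_sym_mats])
qed

text \<open>The numbers a and b are the multipliers: they are nonnegative, the residual lies in the
  polar cone, and it is orthogonal to the projected point. The last clause is an equivalence in q,
  so that it can be applied to an arbitrary candidate for the plastic strain rate; it also shows
  that the overlapping cases agree when \<open>\<alpha>\<^sub>1 = \<alpha>\<^sub>2\<close>.\<close>

lemma two_generator_cone_projection:
  fixes u v \<epsilon> :: "'a::real_inner"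
  assumes "norm u = 1" "norm v = 1" and dlt: "\<bar>\<delta>\<bar> < 1" "\<delta> = u \<bullet> v"
    and a: "\<alpha>\<^sub>1 = \<epsilon> \<bullet> u" "\<alpha>\<^sub>2 = \<epsilon> \<bullet> v"
    and e1: "\<eta>\<^sub>1 = (\<alpha>\<^sub>1 - \<delta> * \<alpha>\<^sub>2) / (1 - \<delta>\<^sup>2)"
    and e2: "\<eta>\<^sub>2 = (\<alpha>\<^sub>2 - \<delta> * \<alpha>\<^sub>1) / (1 - \<delta>\<^sup>2)"
  obtains a b where "a \<ge> 0" "b \<ge> 0"
    "(\<epsilon> - (a *\<^sub>R u + b *\<^sub>R v)) \<bullet> u \<le> 0" "(\<epsilon> - (a *\<^sub>R u + b *\<^sub>R v)) \<bullet> v \<le> 0"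
    "(\<epsilon> - (a *\<^sub>R u + b *\<^sub>R v)) \<bullet> (a *\<^sub>R u + b *\<^sub>R v) = 0"
    "\<forall>q. q = a *\<^sub>R u + b *\<^sub>R v \<longleftrightarrow>
       (\<eta>\<^sub>1 \<ge> 0 \<and> \<eta>\<^sub>2 \<ge> 0 \<longrightarrow> q = \<eta>\<^sub>1 *\<^sub>R u + \<eta>\<^sub>2 *\<^sub>R v) \<and>
       (min \<eta>\<^sub>1 \<eta>\<^sub>2 < 0 \<and> \<alpha>\<^sub>1 \<ge> \<alpha>\<^sub>2 \<longrightarrow> q = max \<alpha>\<^sub>1 0 *\<^sub>R u) \<and>
       (min \<eta>\<^sub>1 \<eta>\<^sub>2 < 0 \<and> \<alpha>\<^sub>1 \<le> \<alpha>\<^sub>2 \<longrightarrow> q = max \<alpha>\<^sub>2 0 *\<^sub>R v)"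
proof -
  have n: "u \<bullet> u = 1" "v \<bullet> v = 1" "u \<bullet> v = \<delta>" "v \<bullet> u = \<delta>"
    using assms by (auto simp: norm_eq_1 inner_commute)
  have pos: "1 - \<delta>\<^sup>2 > 0"
    using dlt(1) by (simp add: abs_square_less_1)
  have iu: "(\<epsilon> - (a *\<^sub>R u + b *\<^sub>R v)) \<bullet> u = \<alpha>\<^sub>1 - a - b * \<delta>"
    and iv: "(\<epsilon> - (a *\<^sub>R u + b *\<^sub>R v)) \<bullet> v = \<alpha>\<^sub>2 - a * \<delta> - b" for a b
    by (simp_all add: inner_diff_left inner_add_left n a)
  have ip: "(\<epsilon> - (a *\<^sub>R u + b *\<^sub>R v)) \<bullet> (a *\<^sub>R u + b *\<^sub>R v)
      = a * (\<alpha>\<^sub>1 - a - b * \<delta>) + b * (\<alpha>\<^sub>2 - a * \<delta> - b)" for a b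
    by (simp only: inner_add_right inner_scaleR_right iu iv)
  \<comment> \<open>This is the residual condition against the other generator when the candidate is
    \<open>max x 0\<close> times the generator with the larger component x. The hard case is x > 0
    and x < \<delta> y: it forces y < 0 and \<delta> < 0, and multiplying by \<delta> gives y <
    \<delta> \<delta> y \<le> \<delta> x.\<close>
  have key: "y \<le> \<delta> * max x 0"
    if "x \<ge> y" "x < \<delta> * y \<or> y < \<delta> * x" for x y
  proof (cases "x \<le> 0 \<or> y < \<delta> * x")
    case True
    then show ?thesis using that(1) by (auto simp: max_def)
  next
    case False
    then have "x > 0" "x < \<delta> * y" using that(2) by auto
    have "y < 0"
    proof (rule ccontr)
      assume "\<not> y < 0"
      then have "\<delta> * y \<le> 1 * y" using dlt(1) by (intro mult_right_mono) auto
      then show False using \<open>x < \<delta> * y\<close> that(1) by simp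
    qed
    then have "\<delta> < 0"
      using \<open>x > 0\<close> \<open>x < \<delta> * y\<close> by (smt (verit) mult_nonneg_nonpos)
    then have "\<delta> * (\<delta> * y) \<le> \<delta> * x"
      using \<open>x < \<delta> * y\<close> by (intro mult_left_mono_neg) auto
    moreover have "(1 - \<delta>\<^sup>2) * y < 0"
      using pos \<open>y < 0\<close> by (rule mult_pos_neg)
    ultimately have "y \<le> \<delta> * x" by (simp add: algebra_simps power2_eq_square)
    then show ?thesis using \<open>x > 0\<close> by simp
  qed
  have sgn: "\<eta>\<^sub>1 < 0 \<longleftrightarrow> \<alpha>\<^sub>1 < \<delta> * \<alpha>\<^sub>2" "\<eta>\<^sub>2 < 0 \<longleftrightarrow> \<alpha>\<^sub>2 < \<delta> * \<alpha>\<^sub>1"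
    using pos by (auto simp: e1 e2 divide_less_0_iff)
  consider (both) "\<eta>\<^sub>1 \<ge> 0" "\<eta>\<^sub>2 \<ge> 0"
    | (one) "min \<eta>\<^sub>1 \<eta>\<^sub>2 < 0" "\<alpha>\<^sub>1 > \<alpha>\<^sub>2"
    | (two) "min \<eta>\<^sub>1 \<eta>\<^sub>2 < 0" "\<alpha>\<^sub>1 < \<alpha>\<^sub>2"
    | (eq) "min \<eta>\<^sub>1 \<eta>\<^sub>2 < 0" "\<alpha>\<^sub>1 = \<alpha>\<^sub>2"
    by linarith
  then show ?thesis
  proof cases
    case both
    \<comment> \<open>The pair \<open>\<eta>\<^sub>1\<close>, \<open>\<eta>\<^sub>2\<close> solves
      the Gram system of u and v, so the residual is orthogonal to both generators.\<close>
    have "\<alpha>\<^sub>1 - \<eta>\<^sub>1 - \<eta>\<^sub>2 * \<delta> = 0" "\<alpha>\<^sub>2 - \<eta>\<^sub>1 * \<delta> - \<eta>\<^sub>2 = 0"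
      using pos unfolding e1 e2 by (simp_all add: field_simps power2_eq_square)
    then show ?thesis
      using both by (intro that[of \<eta>\<^sub>1 \<eta>\<^sub>2]) (unfold ip iu iv, auto)
  next
    case one
    then have "\<alpha>\<^sub>2 \<le> \<delta> * max \<alpha>\<^sub>1 0"
      by (intro key) (auto simp: sgn min_less_iff_disj)
    then show ?thesis
      using one by (intro that[of "max \<alpha>\<^sub>1 0" 0]) (unfold ip iu iv, auto simp: mult.commute max_def)
  next
    case two
    then have "\<alpha>\<^sub>1 \<le> \<delta> * max \<alpha>\<^sub>2 0"
      by (intro key) (auto simp: sgn min_less_iff_disj)
    then show ?thesis
      using two by (intro that[of 0 "max \<alpha>\<^sub>2 0"]) (unfold ip iu iv, auto simp: mult.commute max_def)
  next
    case eq
    \<comment> \<open>In a tie, a negative coefficient forces the common component to be negative,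
      so both one-generator formulas give 0.\<close>
    then have "(1 - \<delta>) * \<alpha>\<^sub>1 < 0"
      by (auto simp: sgn min_less_iff_disj algebra_simps)
    then have "\<alpha>\<^sub>1 < 0" using dlt(1) by (auto simp: mult_less_0_iff)
    then show ?thesis
      using eq by (intro that[of 0 0]) (unfold ip iu iv, auto)
  qed
qed

section \<open>Equivalence of the projection laws and the explicit flow rule\<close>

theorem theorem3p2:
  fixes f :: "nat \<Rightarrow> real^3^3 \<Rightarrow> real" and k :: "nat \<Rightarrow> real" and m :: nat
    and C :: "(real^3^3) set" and \<sigma> \<sigma>star :: "real^3^3"
    and lam \<mu> :: real
    and g\<^sub>1 g\<^sub>2 :: "real^3^3" and \<alpha>\<^sub>1 \<alpha>\<^sub>2 \<delta> \<eta>\<^sub>1 \<eta>\<^sub>2 :: real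
    and \<epsilon> \<epsilon>e \<epsilon>p \<sigma>dot :: "real^3^3"
  assumes "lam > 0" and "\<mu> > 0"
    and "m \<ge> 2"
    and "\<And>i. i \<in> {1..m} \<Longrightarrow> convex_on sym_mats (f i)"
    and "\<And>i. i \<in> {1..m} \<Longrightarrow> C1_sym (f i)"
    and C_def: "C = {\<tau> \<in> sym_mats. \<forall>i\<in>{1..m}. f i \<tau> \<le> k i}"
    and "\<sigma>star \<in> sym_mats" and "\<And>i. i \<in> {1..m} \<Longrightarrow> f i \<sigma>star < k i"
    and "\<And>\<tau> p. \<tau> \<in> C \<Longrightarrow> \<tau> + p *\<^sub>R mat 1 \<in> C"
    and "\<sigma> \<in> C"
    and "f 1 \<sigma> = k 1" and "f 2 \<sigma> = k 2"
    and "\<And>i. i \<in> {3..m} \<Longrightarrow> f i \<sigma> < k i"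
    and g1_def: "g\<^sub>1 = sym_grad (f 1) \<sigma>" and g2_def: "g\<^sub>2 = sym_grad (f 2) \<sigma>"
    and "\<not> collinear {0, g\<^sub>1, g\<^sub>2}"
    and "\<epsilon> \<in> sym_mats" and "\<epsilon>e \<in> sym_mats" and "\<epsilon>p \<in> sym_mats" and "\<sigma>dot \<in> sym_mats"
    and \<alpha>1_def: "\<alpha>\<^sub>1 = (\<epsilon> \<bullet> g\<^sub>1) / norm g\<^sub>1"
    and \<alpha>2_def: "\<alpha>\<^sub>2 = (\<epsilon> \<bullet> g\<^sub>2) / norm g\<^sub>2"
    and \<delta>_def: "\<delta> = (g\<^sub>1 \<bullet> g\<^sub>2) / (norm g\<^sub>1 * norm g\<^sub>2)"
    and \<eta>1_def: "\<eta>\<^sub>1 = (\<alpha>\<^sub>1 - \<delta> * \<alpha>\<^sub>2) / (1 - \<delta>\<^sup>2)"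
    and \<eta>2_def: "\<eta>\<^sub>2 = (\<alpha>\<^sub>2 - \<delta> * \<alpha>\<^sub>1) / (1 - \<delta>\<^sup>2)"
  shows "(\<epsilon>e = closest_point (tangent_cone C \<sigma>) \<epsilon> \<and>
          \<epsilon>p = closest_point (normal_cone C \<sigma>) \<epsilon> \<and>
          \<sigma>dot = closest_point (tangent_cone C \<sigma>) (elasticity lam \<mu> \<epsilon>))
     \<longleftrightarrow>
         ((\<eta>\<^sub>1 \<ge> 0 \<and> \<eta>\<^sub>2 \<ge> 0 \<longrightarrow>
             \<epsilon>p = \<eta>\<^sub>1 *\<^sub>R (g\<^sub>1 /\<^sub>R norm g\<^sub>1) + \<eta>\<^sub>2 *\<^sub>R (g\<^sub>2 /\<^sub>R norm g\<^sub>2)) \<and>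
          (min \<eta>\<^sub>1 \<eta>\<^sub>2 < 0 \<and> \<alpha>\<^sub>1 \<ge> \<alpha>\<^sub>2 \<longrightarrow> \<epsilon>p = max \<alpha>\<^sub>1 0 *\<^sub>R (g\<^sub>1 /\<^sub>R norm g\<^sub>1)) \<and>
          (min \<eta>\<^sub>1 \<eta>\<^sub>2 < 0 \<and> \<alpha>\<^sub>1 \<le> \<alpha>\<^sub>2 \<longrightarrow> \<epsilon>p = max \<alpha>\<^sub>2 0 *\<^sub>R (g\<^sub>2 /\<^sub>R norm g\<^sub>2)) \<and>
          \<epsilon>e = \<epsilon> - \<epsilon>p \<and>
          \<sigma>dot = (lam * trace \<epsilon>) *\<^sub>R mat 1 + (2 * \<mu>) *\<^sub>R \<epsilon> - (2 * \<mu>) *\<^sub>R \<epsilon>p)"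
proof -
  let ?T = "tangent_cone C \<sigma>" and ?N = "normal_cone C \<sigma>"
  let ?u = "g\<^sub>1 /\<^sub>R norm g\<^sub>1" and ?v = "g\<^sub>2 /\<^sub>R norm g\<^sub>2"
  have \<sigma>: "\<sigma> \<in> sym_mats" using \<open>\<sigma> \<in> C\<close> C_def by simp
  have diff: "f i differentiable (at \<sigma> within sym_mats)" if "i \<in> {1..m}" for i
    using assms(5)[OF that] \<sigma> by (simp add: C1_sym_def)
  note grad = sym_grad_works[OF diff \<sigma>]
  have g: "g\<^sub>1 \<in> sym_mats" "g\<^sub>2 \<in> sym_mats"
    using grad(1)[of 1] grad(1)[of 2] \<open>m \<ge> 2\<close> by (auto simp: g1_def g2_def)
  have "?T = {\<tau> \<in> sym_mats. \<forall>i\<in>{1,2}. sym_grad (f i) \<sigma> \<bullet> \<tau> \<le> 0}"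
  proof (rule tangent_cone_active[OF finite_atLeastAtMost assms(4) grad(2) C_def assms(7,8,10)])
    fix i assume "i \<in> {1..m} - {1,2}"
    then have "i \<in> {3..m}" by auto
    then show "f i \<sigma> < k i" by (rule assms(13))
  qed (use assms in auto)
  then have T: "?T = {\<tau> \<in> sym_mats. \<tau> \<bullet> g\<^sub>1 \<le> 0 \<and> \<tau> \<bullet> g\<^sub>2 \<le> 0}"
    by (simp add: g1_def g2_def inner_commute)
  have g0: "g\<^sub>1 \<noteq> 0" "g\<^sub>2 \<noteq> 0"
    using \<open>\<not> collinear {0, g\<^sub>1, g\<^sub>2}\<close> by (auto simp: insert_commute)
  \<comment> \<open>Equality in Cauchy-Schwarz would make the gradients collinear; strictness keeps
    \<open>1 - \<delta>\<^sup>2\<close> positive.\<close>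
  have "\<bar>g\<^sub>1 \<bullet> g\<^sub>2\<bar> < norm g\<^sub>1 * norm g\<^sub>2"
    using Cauchy_Schwarz_ineq2[of g\<^sub>1 g\<^sub>2] norm_cauchy_schwarz_equal[of g\<^sub>1 g\<^sub>2]
      \<open>\<not> collinear {0, g\<^sub>1, g\<^sub>2}\<close> by linarith
  then have dlt: "\<bar>\<delta>\<bar> < 1" using g0 by (simp add: \<delta>_def abs_mult)
  have u: "norm ?u = 1" "norm ?v = 1" using g0 by auto
  have duv: "\<delta> = ?u \<bullet> ?v" by (simp add: \<delta>_def field_simps)
  have al: "\<alpha>\<^sub>1 = \<epsilon> \<bullet> ?u" "\<alpha>\<^sub>2 = \<epsilon> \<bullet> ?v"
    by (simp_all add: \<alpha>1_def \<alpha>2_def field_simps)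
  obtain a b where ab: "a \<ge> 0" "b \<ge> 0"
    and pu: "(\<epsilon> - (a *\<^sub>R ?u + b *\<^sub>R ?v)) \<bullet> ?u \<le> 0"
    and pv: "(\<epsilon> - (a *\<^sub>R ?u + b *\<^sub>R ?v)) \<bullet> ?v \<le> 0"
    and orth: "(\<epsilon> - (a *\<^sub>R ?u + b *\<^sub>R ?v)) \<bullet> (a *\<^sub>R ?u + b *\<^sub>R ?v) = 0"
    and formula: "\<forall>q. q = a *\<^sub>R ?u + b *\<^sub>R ?v \<longleftrightarrow>
       (\<eta>\<^sub>1 \<ge> 0 \<and> \<eta>\<^sub>2 \<ge> 0 \<longrightarrow> q = \<eta>\<^sub>1 *\<^sub>R ?u + \<eta>\<^sub>2 *\<^sub>R ?v) \<and>
       (min \<eta>\<^sub>1 \<eta>\<^sub>2 < 0 \<and> \<alpha>\<^sub>1 \<ge> \<alpha>\<^sub>2 \<longrightarrow> q = max \<alpha>\<^sub>1 0 *\<^sub>R ?u) \<and>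
       (min \<eta>\<^sub>1 \<eta>\<^sub>2 < 0 \<and> \<alpha>\<^sub>1 \<le> \<alpha>\<^sub>2 \<longrightarrow> q = max \<alpha>\<^sub>2 0 *\<^sub>R ?v)"
    by (rule two_generator_cone_projection[OF u dlt duv al \<eta>1_def \<eta>2_def])
  define p where "p = a *\<^sub>R ?u + b *\<^sub>R ?v"
  have p: "p \<in> sym_mats"
    unfolding p_def using g subspace_sym_mats by (simp add: subspace_add subspace_scale)
  have scaled: "x \<bullet> (y /\<^sub>R norm y) \<le> 0 \<Longrightarrow> x \<bullet> y \<le> 0" if "y \<noteq> 0" for x y :: "real^3^3"
    using that by (simp add: divide_le_0_iff field_simps)
  have "(\<epsilon> - p) \<bullet> g\<^sub>1 \<le> 0" "(\<epsilon> - p) \<bullet> g\<^sub>2 \<le> 0"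
    using pu pv g0 scaled unfolding p_def by blast+
  then have epT: "\<epsilon> - p \<in> ?T"
    using p \<open>\<epsilon> \<in> sym_mats\<close> subspace_sym_mats by (simp add: T subspace_diff)
  \<comment> \<open>Together with \<open>epT\<close> and \<open>orth\<close>, this is the Moreau
    criterion that yields both projections of \<epsilon>.\<close>
  have polar: "\<tau> \<bullet> p \<le> 0" if "\<tau> \<in> ?T" for \<tau>
  proof -
    have "\<tau> \<bullet> ?u \<le> 0" "\<tau> \<bullet> ?v \<le> 0"
      using that by (simp_all add: T mult_nonneg_nonpos)
    then have "a * (\<tau> \<bullet> ?u) + b * (\<tau> \<bullet> ?v) \<le> 0"
      using ab by (intro add_nonpos_nonpos mult_nonneg_nonpos)
    then show ?thesis
      unfolding p_def inner_add_right inner_scaleR_right .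
  qed
  have orth: "(\<epsilon> - p) \<bullet> p = 0" using orth by (simp add: p_def)
  have Tclosed: "closed ?T" by (simp add: tangent_cone_def)
  have "?T = sym_mats \<inter> {\<tau>. g\<^sub>1 \<bullet> \<tau> \<le> 0} \<inter> {\<tau>. g\<^sub>2 \<bullet> \<tau> \<le> 0}"
    by (auto simp: T inner_commute)
  then have Tconvex: "convex ?T"
    by (auto intro!: convex_Int convex_halfspace_le subspace_imp_convex[OF subspace_sym_mats])
  have projN: "closest_point ?N \<epsilon> = p"
  proof (rule closest_point_eqI[OF closed_normal_cone convex_normal_cone])
    show "p \<in> ?N" using p polar by (simp add: normal_cone_def)
    fix x assume "x \<in> ?N"
    then show "(\<epsilon> - p) \<bullet> (x - p) \<le> 0"
      using epT orth by (simp add: normal_cone_def inner_diff_right)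
  qed
  have projT: "closest_point ?T \<epsilon> = \<epsilon> - p"
  proof (rule closest_point_eqI[OF Tclosed Tconvex epT])
    fix x assume "x \<in> ?T"
    then show "(\<epsilon> - (\<epsilon> - p)) \<bullet> (x - (\<epsilon> - p)) \<le> 0"
      using polar[of x] orth by (simp add: inner_diff_right inner_commute)
  qed
  \<comment> \<open>Used with c = 1 and c = -1: both signs of the half-space conditions make the
    identity orthogonal to both gradients.\<close>
  have "c *\<^sub>R mat 1 \<in> ?T" for c
  proof -
    have "1 *\<^sub>R ((\<sigma> + c *\<^sub>R mat 1) - \<sigma>) \<in> ?T"
      unfolding tangent_cone_def
    proof (rule subsetD[OF closure_subset], rule CollectI, intro exI conjI)
      show "\<sigma> + c *\<^sub>R mat 1 \<in> C" using assms(9)[OF \<open>\<sigma> \<in> C\<close>] .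
    qed (rule refl, rule zero_less_one)
    then show ?thesis by simp
  qed
  from this[of 1] this[of "-1"]
  have I: "mat 1 \<in> sym_mats" "mat 1 \<bullet> g\<^sub>1 = 0" "mat 1 \<bullet> g\<^sub>2 = 0"
    by (auto simp: T)
  \<comment> \<open>The candidate keeps the hydrostatic term, which is tangent in both directions,
    and scales the projection of \<epsilon>. The residual is then
    \<open>(2 * \<mu>) *\<^sub>R p\<close>, a normal direction orthogonal to s.\<close>
  define s where "s = (lam * trace \<epsilon>) *\<^sub>R mat 1 + (2 * \<mu>) *\<^sub>R (\<epsilon> - p)"
  have "closest_point ?T (elasticity lam \<mu> \<epsilon>) = s"
  proof (rule closest_point_eqI[OF Tclosed Tconvex])
    show "s \<in> ?T"
      using epT I \<open>\<mu> > 0\<close> subspace_sym_mats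
      by (simp add: T s_def subspace_add subspace_scale inner_add_left mult_nonneg_nonpos)
    fix x assume "x \<in> ?T"
    have "elasticity lam \<mu> \<epsilon> - s = (2 * \<mu>) *\<^sub>R p"
      by (simp add: elasticity_def s_def algebra_simps)
    moreover have "mat 1 \<bullet> p = 0"
      using I by (simp add: p_def inner_add_right)
    then have "p \<bullet> s = 0"
      using orth by (simp add: s_def inner_add_right inner_commute[of p])
    ultimately show "(elasticity lam \<mu> \<epsilon> - s) \<bullet> (x - s) \<le> 0"
      using polar[OF \<open>x \<in> ?T\<close>] \<open>\<mu> > 0\<close>
      by (simp add: inner_diff_right inner_commute[of p x] mult_nonneg_nonpos)
  qed
  then have projH: "closest_point ?T (elasticity lam \<mu> \<epsilon>)
      = (lam * trace \<epsilon>) *\<^sub>R mat 1 + (2 * \<mu>) *\<^sub>R \<epsilon> - (2 * \<mu>) *\<^sub>R p"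
    by (simp add: s_def scaleR_diff_right)
  \<comment> \<open>With the three projections computed, the case formula says exactly that
    \<open>\<epsilon>p\<close> equals \<open>p\<close>, and the other two laws follow by
    substitution.\<close>
  show ?thesis
    unfolding projN projT projH using formula[folded p_def, THEN spec[of _ \<epsilon>p]] by auto
qed

end
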